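(* For each integer $n \geq 12$ there exists a system $S \subseteq E_n$ such that $S$ has infinitely many integer solutions $(x_1,\ldots,x_n) \in \mathbb{Z}^n$ and all of these solutions belong to $\mathbb{Z}^n \setminus \left[-2^{2^{n-1}},\, 2^{2^{n-1}}\right]^n$.
   Context: For a positive integer $n$, $E_n$ denotes the following finite set of equations in the variables $x_1,\ldots,x_n$: $$E_n=\{x_i=1,\ x_i+x_j=x_k,\ x_i \cdot x_j=x_k:\ i,j,k \in \{1,\ldots,n\}\}$$ (the indices $i,j,k$ need not be distinct). A system $S \subseteq E_n$ is a subset of these equations. An integer solution of $S$ is a tuple $(x_1,\ldots,x_n)\in\mathbb{Z}^n$ satisfying every equation in $S$. A tuple belongs to $\mathbb{Z}^n \setminus [-B,B]^n$ if and only if it is an integer tuple with at least one coordinate of absolute value greater than $B$. *)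

theory Defs
  imports "HOL-Library.FuncSet"
begin

text \<open>
  Equations are kept as syntactic objects: \<open>EqOne i\<close>, \<open>EqAdd i j k\<close> and \<open>EqMult i j k\<close> stand for
  \<open>x\<^sub>i = 1\<close>, \<open>x\<^sub>i + x\<^sub>j = x\<^sub>k\<close> and \<open>x\<^sub>i \<cdot> x\<^sub>j = x\<^sub>k\<close>.
\<close>

datatype equation = EqOne nat | EqAdd nat nat nat | EqMult nat nat nat

definition E :: "nat \<Rightarrow> equation set" where
  "E n = {EqOne i | i. i \<in> {1..n}}
       \<union> {EqAdd i j k | i j k. i \<in> {1..n} \<and> j \<in> {1..n} \<and> k \<in> {1..n}}
       \<union> {EqMult i j k | i j k. i \<in> {1..n} \<and> j \<in> {1..n} \<and> k \<in> {1..n}}"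

fun satisfies :: "(nat \<Rightarrow> int) \<Rightarrow> equation \<Rightarrow> bool" where
  "satisfies x (EqOne i) \<longleftrightarrow> x i = 1"
| "satisfies x (EqAdd i j k) \<longleftrightarrow> x i + x j = x k"
| "satisfies x (EqMult i j k) \<longleftrightarrow> x i * x j = x k"

text \<open>
  An \<open>n\<close>-tuple over \<open>A\<close> is a function that is \<open>undefined\<close> outside \<open>{1..n}\<close>, so distinct functions
  are distinct tuples and sets of tuples have the intended cardinality.
\<close>

definition tuples :: "nat \<Rightarrow> int set \<Rightarrow> (nat \<Rightarrow> int) set" where
  "tuples n A = {1..n} \<rightarrow>\<^sub>E A"

definition int_solutions :: "nat \<Rightarrow> equation set \<Rightarrow> (nat \<Rightarrow> int) set" where
  "int_solutions n S = {x \<in> tuples n UNIV. \<forall>e\<in>S. satisfies x e}"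

end

theory Submission
  imports Defs "HOL-Computational_Algebra.Primes"
begin

text \<open>
  The Pell equation \<open>x\<^sup>2 = 2y\<^sup>2 + 1\<close> has solutions that grow exponentially in their index, and a
  divisibility condition on \<open>x\<close> can force that index to be large. Write
  \<open>x\<^sub>k + y\<^sub>k \<surd>2 = (3 + 2\<surd>2)\<^sup>k\<close>. Tripling the index gives \<open>x\<^bsub>3k\<^esub> = x\<^sub>k (4x\<^sub>k\<^sup>2 - 3)\<close>, and if \<open>3\<close> divides
  \<open>x\<^sub>k\<close> then the second factor is divisible by \<open>3\<close> exactly once. So each further factor \<open>3\<close> in \<open>x\<close>
  costs a factor \<open>3\<close> in the index: \<open>3\<^bsup>j+1\<^esup>\<close> divides \<open>x\<^sub>k\<close> only if \<open>3\<^sup>j\<close> divides \<open>k\<close>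
  (\<open>three_power_dvd_pell_index\<close>), while \<open>3\<^bsup>j+1\<^esup>\<close> does divide \<open>x\<^sub>k\<close> for \<open>k = 3\<^sup>j\<close>
  (\<open>three_power_dvd_pell_x\<close>).

  Now \<open>3\<^sup>8 = ((3\<^sup>2)\<^sup>2)\<^sup>2\<close> is cheap to express, and the conditions \<open>x\<^sup>2 = 2y\<^sup>2 + 1\<close> and \<open>x = 3\<^sup>8 z\<close>
  together fit into twelve variables with the values
  \<open>1, 2, 3, 3\<^sup>2, 3\<^sup>4, 3\<^sup>8, z, x, y, y\<^sup>2, 2y\<^sup>2, x\<^sup>2\<close>.
  The indices \<open>k = 3\<^bsup>7+m\<^esup>\<close> provide infinitely many solutions. Conversely, every solution is
  \<open>(\<plusminus>x\<^sub>k, \<plusminus>y\<^sub>k)\<close> for some \<open>k\<close> (\<open>pell_solution_is_power\<close>), and then \<open>k \<ge> 3\<^sup>7 = 2187\<close>, so that \<open>x\<^sup>2 \<ge> 2\<^bsup>2k\<^esup> > 2\<^bsup>2048\<^esup>\<close>. The trivial solution \<open>x = \<plusminus>1\<close>, \<open>y = 0\<close>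
  is excluded because the divisibility condition is put on \<open>x\<close> and not on \<open>y\<close>.
  For \<open>n > 12\<close> each additional variable is the square of the preceding one, which matches the
  squaring of the bound \<open>2 ^ 2 ^ (n - 1)\<close> when \<open>n\<close> increases by one.
\<close>

section \<open>Solutions of the Pell equation\<close>

fun pell_x :: "nat \<Rightarrow> int" and pell_y :: "nat \<Rightarrow> int" where
  "pell_x 0 = 1"
| "pell_y 0 = 0"
| "pell_x (Suc k) = 3 * pell_x k + 4 * pell_y k"
| "pell_y (Suc k) = 2 * pell_x k + 3 * pell_y k"

lemma pell_equation: "(pell_x k)\<^sup>2 = 2 * (pell_y k)\<^sup>2 + 1"
  by (induction k) (simp_all add: power2_eq_square algebra_simps)

lemma pell_nonneg: "0 < pell_x k \<and> 0 \<le> pell_y k"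
  by (induction k) auto

lemma pell_x_ge_power: "2 ^ k \<le> pell_x k"
proof (induction k)
  case (Suc k)
  then show ?case
    using pell_nonneg[of k] by simp
qed simp

lemma strict_mono_pell_x: "strict_mono pell_x"
proof (rule strict_mono_Suc_iff[THEN iffD2], rule allI)
  fix k
  show "pell_x k < pell_x (Suc k)"
    using pell_nonneg[of k] by simp
qed

text \<open>
  Descent: multiplying \<open>x + y\<surd>2\<close> by \<open>3 - 2\<surd>2 = (3 + 2\<surd>2)\<^sup>-\<^sup>1\<close> gives a solution with smaller \<open>y\<close>,
  which is still nonnegative because there is no solution with \<open>y = 1\<close>.
\<close>

lemma pell_solution_is_power:
  fixes x y :: int
  assumes "x\<^sup>2 = 2 * y\<^sup>2 + 1" "0 \<le> x" "0 \<le> y"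
  shows "\<exists>k. x = pell_x k \<and> y = pell_y k"
  using assms
proof (induction "nat y" arbitrary: x y rule: less_induct)
  case less
  show ?case
  proof (cases "y = 0")
    case True
    then have "x = 1"
      using less.prems by (simp add: power2_eq_1_iff)
    then have "x = pell_x 0 \<and> y = pell_y 0"
      using True by simp
    then show ?thesis by blast
  next
    case False
    have "y \<noteq> 1"
    proof
      assume "y = 1"
      then have x2: "x\<^sup>2 = 3"
        using less.prems by simp
      have "x < 2"
        by (rule power2_less_imp_less) (use x2 in simp_all)
      then have "x = 0 \<or> x = 1"
        using less.prems by linarith
      then show False
        using x2 by auto
    qed
    then have y2: "2 \<le> y"
      using False less.prems by linarith
    then have "2\<^sup>2 \<le> y\<^sup>2"
      by (intro power_mono) simp_all
    then have yy: "4 \<le> y\<^sup>2"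
      by simp
    have xy: "y < x"
      by (rule power2_less_imp_less) (use less.prems yy in linarith)+
    have "2 * x \<le> 3 * y"
      by (rule power2_le_imp_le) (use less.prems yy in \<open>simp_all add: power_mult_distrib\<close>)
    moreover have "4 * y \<le> 3 * x"
      by (rule power2_le_imp_le) (use less.prems yy in \<open>simp_all add: power_mult_distrib\<close>)
    moreover have "(3 * x - 4 * y)\<^sup>2 = 2 * (3 * y - 2 * x)\<^sup>2 + 1"
      using less.prems by (simp add: power2_eq_square algebra_simps)
    moreover have "nat (3 * y - 2 * x) < nat y"
      using xy y2 by linarith
    ultimately obtain k where "3 * x - 4 * y = pell_x k" "3 * y - 2 * x = pell_y k"
      using less.hyps[of "3 * y - 2 * x" "3 * x - 4 * y"] by auto
    then have "x = pell_x (Suc k) \<and> y = pell_y (Suc k)"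
      by simp
    then show ?thesis by blast
  qed
qed

section \<open>Powers of three in the Pell sequence\<close>

lemma pell_add:
  "pell_x (j + k) = pell_x j * pell_x k + 2 * pell_y j * pell_y k \<and>
   pell_y (j + k) = pell_x j * pell_y k + pell_y j * pell_x k"
  by (induction j) (simp_all add: algebra_simps)

text \<open>The triplication formula of the Chebyshev polynomials: \<open>x\<^sub>k\<close> is a hyperbolic cosine.\<close>

lemma pell_x_triple: "pell_x (3 * k) = pell_x k * (4 * (pell_x k)\<^sup>2 - 3)"
proof -
  have "pell_x (3 * k) = pell_x (k + (k + k))"
    by (simp add: mult.commute numeral_3_eq_3)
  also have "\<dots> = pell_x k * ((pell_x k)\<^sup>2 + 3 * (2 * (pell_y k)\<^sup>2))"
    by (simp only: pell_add) (simp add: power2_eq_square algebra_simps)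
  also have "\<dots> = pell_x k * (4 * (pell_x k)\<^sup>2 - 3)"
    using pell_equation[of k] by simp
  finally show ?thesis .
qed

lemma three_power_dvd_pell_x: "3 ^ Suc j dvd pell_x (3 ^ j)"
proof (induction j)
  case 0
  then show ?case by simp
next
  case (Suc j)
  then have "3 dvd pell_x (3 ^ j)"
    by (auto dest: dvd_mult_left)
  then have "3 dvd 4 * (pell_x (3 ^ j))\<^sup>2 - 3"
    by (simp add: power2_eq_square)
  with Suc have "3 ^ Suc j * 3 dvd pell_x (3 ^ j) * (4 * (pell_x (3 ^ j))\<^sup>2 - 3)"
    by (rule mult_dvd_mono)
  then show ?case
    by (simp add: pell_x_triple mult.commute)
qed

text \<open>
  Modulo \<open>9\<close>, a shift of the index by \<open>3\<close> multiplies by \<open>(3 + 2\<surd>2)\<^sup>3 = 99 + 70\<surd>2 \<equiv> 7\<surd>2\<close>, that is,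
  it exchanges \<open>x\<close> and \<open>y\<close> up to units. The induction therefore runs over both sequences at once.
\<close>

lemma nine_dvd_pell: "9 dvd pell_x k \<or> 9 dvd pell_y k \<Longrightarrow> 3 dvd k"
proof (induction k rule: less_induct)
  case (less k)
  consider "k = 0" | "k = 1" | "k = 2" | l where "k = l + 3"
    by (metis add.commute le_Suc_ex less_Suc_eq less_one not_less numeral_2_eq_2 numeral_3_eq_3
        One_nat_def)
  then show ?case
  proof cases
    case 4
    have "pell_x k = 9 * (11 * pell_x l + 15 * pell_y l) + 5 * pell_y l"
      "pell_y k = 9 * (7 * pell_x l + 11 * pell_y l) + 7 * pell_x l"
      by (simp_all add: 4 numeral_3_eq_3)
    moreover have "9 dvd 9 * a + 5 * b \<Longrightarrow> 9 dvd b" "9 dvd 9 * a + 7 * b \<Longrightarrow> 9 dvd b" for a b :: int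
      by presburger+
    ultimately have "9 dvd pell_x l \<or> 9 dvd pell_y l"
      using less.prems by metis
    then have "3 dvd l"
      using less.IH[of l] 4 by simp
    then show ?thesis
      using 4 by simp
  qed (use less.prems in \<open>simp_all add: numeral_2_eq_2\<close>)
qed

text \<open>
  The converse of \<open>three_power_dvd_pell_x\<close>, up to multiples. The step undoes one tripling: by
  the case of modulus \<open>9\<close> the index is \<open>3l\<close>, and in \<open>x\<^bsub>3l\<^esub> = x\<^sub>l (4x\<^sub>l\<^sup>2 - 3)\<close> the cofactor
  absorbs just one factor \<open>3\<close>, so that \<open>x\<^sub>l\<close> carries all the others.
\<close>

theorem three_power_dvd_pell_index: "3 ^ Suc j dvd pell_x k \<Longrightarrow> 3 ^ j dvd k"
proof (induction j arbitrary: k)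
  case 0
  then show ?case by simp
next
  case (Suc j)
  have "(9::int) dvd 3 ^ Suc (Suc j)"
    by simp
  then have "9 dvd pell_x k"
    using Suc.prems by (rule dvd_trans)
  then obtain l where k: "k = 3 * l"
    using nine_dvd_pell by blast
  let ?x = "pell_x l"
  have dvd: "3 ^ Suc (Suc j) dvd ?x * (4 * ?x\<^sup>2 - 3)"
    using Suc.prems by (simp add: k pell_x_triple)
  then have "3 dvd ?x * (4 * ?x\<^sup>2 - 3)"
    by (auto dest: dvd_mult_left)
  \<comment> \<open>The product is \<open>4x\<^sup>3 - 3x\<close>, which is congruent to \<open>x\<^sup>3\<close> modulo \<open>3\<close>.\<close>
  then have "3 dvd ?x * (4 * ?x\<^sup>2 - 3) - 3 * (?x ^ 3 - ?x)"
    by (rule dvd_diff) simp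
  also have "?x * (4 * ?x\<^sup>2 - 3) - 3 * (?x ^ 3 - ?x) = ?x ^ 3"
    by (simp add: power2_eq_square power3_eq_cube algebra_simps)
  finally have "3 dvd ?x"
    by (rule prime_dvd_power[rotated]) simp
  then obtain c where c: "?x = 3 * c" ..
  have "?x * (4 * ?x\<^sup>2 - 3) = 3 * (?x * (12 * c\<^sup>2 - 1))"
    by (simp add: c power_mult_distrib)
  with dvd have "3 * 3 ^ Suc j dvd 3 * (?x * (12 * c\<^sup>2 - 1))"
    by simp
  then have "3 ^ Suc j dvd ?x * (12 * c\<^sup>2 - 1)"
    by (simp only: dvd_mult_cancel_left) simp
  moreover have "coprime (3 ^ Suc j) (12 * c\<^sup>2 - 1)"
  proof -
    have "coprime 3 (12 * c\<^sup>2 - 1)"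
    proof (rule coprimeI)
      fix d :: int
      assume "d dvd 3" "d dvd 12 * c\<^sup>2 - 1"
      then have "d dvd 3 * (4 * c\<^sup>2) - (12 * c\<^sup>2 - 1)"
        by (metis dvd_diff dvd_mult2)
      then show "is_unit d"
        by simp
    qed
    then show ?thesis by simp
  qed
  ultimately have "3 ^ Suc j dvd ?x"
    by (simp add: coprime_dvd_mult_left_iff)
  then show ?case
    using Suc.IH k by simp
qed

lemma pell_x_lower_bound:
  fixes x y :: int
  assumes "x\<^sup>2 = 2 * y\<^sup>2 + 1" "3 ^ Suc j dvd x"
  shows "2 ^ 3 ^ j \<le> \<bar>x\<bar>"
proof -
  obtain k where k: "\<bar>x\<bar> = pell_x k"
    using pell_solution_is_power[of "\<bar>x\<bar>" "\<bar>y\<bar>"] assms by auto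
  then have dvd: "3 ^ Suc j dvd pell_x k"
    using assms by (metis dvd_abs_iff)
  then have "3 dvd pell_x k"
    by (auto dest: dvd_mult_left)
  then have "k > 0"
    by (cases k) simp_all
  then have "3 ^ j \<le> k"
    using three_power_dvd_pell_index[OF dvd] by (simp add: dvd_imp_le)
  then have "(2::int) ^ 3 ^ j \<le> 2 ^ k"
    by (simp add: power_increasing)
  also have "\<dots> \<le> pell_x k"
    by (rule pell_x_ge_power)
  finally show ?thesis
    using k by simp
qed

section \<open>The system of equations\<close>

text \<open>
  Variables \<open>3\<close> to \<open>6\<close> build \<open>3\<^sup>8\<close>, variable \<open>8\<close> is \<open>x = 3\<^sup>8 z\<close> and variable \<open>9\<close> is \<open>y\<close>. Variable \<open>12\<close>
  occurs as the result of two equations, once as \<open>2y\<^sup>2 + 1\<close> and once as \<open>x\<^sup>2\<close>: this is the Pell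
  equation. The remaining equations form the chain of squarings.
\<close>

definition pell_system :: "nat \<Rightarrow> equation set" where
  "pell_system n =
    {EqOne 1, EqAdd 1 1 2, EqAdd 1 2 3, EqMult 3 3 4, EqMult 4 4 5, EqMult 5 5 6,
     EqMult 6 7 8, EqMult 9 9 10, EqAdd 10 10 11, EqAdd 11 1 12, EqMult 8 8 12} \<union>
    {EqMult i i (Suc i) | i. 12 \<le> i \<and> i < n}"

lemma pell_system_subset: "12 \<le> n \<Longrightarrow> pell_system n \<subseteq> E n"
  by (auto simp: pell_system_def E_def)

text \<open>
  From the twelfth variable on, the values are \<open>x\<^sup>2, x\<^sup>4, x\<^sup>8, \<dots>\<close> with \<open>x = 3\<^sup>8 z\<close>; the offset \<open>11\<close>
  makes the twelfth one \<open>x\<^sup>2\<close>.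
\<close>

definition pell_tuple :: "nat \<Rightarrow> int \<Rightarrow> int \<Rightarrow> nat \<Rightarrow> int" where
  "pell_tuple n z y = (\<lambda>i\<in>{1..n}.
    if i < 12 then [1, 2, 3, 3\<^sup>2, 3 ^ 4, 3 ^ 8, z, 3 ^ 8 * z, y, y\<^sup>2, 2 * y\<^sup>2] ! (i - 1)
    else (3 ^ 8 * z) ^ 2 ^ (i - 11))"

lemma pell_tuple_solution:
  assumes "12 \<le> n" "(3 ^ 8 * z)\<^sup>2 = 2 * y\<^sup>2 + 1"
  shows "pell_tuple n z y \<in> int_solutions n (pell_system n)"
proof -
  have chain: "pell_tuple n z y i = (3 ^ 8 * z) ^ 2 ^ (i - 11)" if "12 \<le> i" "i \<le> n" for i
    using that by (simp add: pell_tuple_def)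
  have "satisfies (pell_tuple n z y) (EqMult i i (Suc i))" if "12 \<le> i" "i < n" for i
  proof -
    have "Suc i - 11 = Suc (i - 11)"
      using that by (intro Suc_diff_le) simp
    then have "2 ^ (Suc i - 11) = (2::nat) ^ (i - 11) + 2 ^ (i - 11)"
      by (simp only: power_Suc mult_2)
    then have "(3 ^ 8 * z) ^ 2 ^ (Suc i - 11) = (3 ^ 8 * z) ^ 2 ^ (i - 11) * (3 ^ 8 * z) ^ 2 ^ (i - 11)"
      by (simp only: power_add)
    then show ?thesis
      using that chain[of i] chain[of "Suc i"] by simp
  qed
  moreover have "pell_tuple n z y \<in> tuples n UNIV"
    by (simp add: pell_tuple_def tuples_def)
  moreover have "pell_tuple n z y 12 = (3 ^ 8 * z)\<^sup>2"
    using assms(1) chain[of 12] by simp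
  ultimately show ?thesis
    using assms
    by (auto simp: int_solutions_def pell_system_def pell_tuple_def power2_eq_square)
qed

lemma infinite_pell_system_solutions:
  assumes "12 \<le> n"
  shows "infinite (int_solutions n (pell_system n))"
proof -
  define f where "f m = pell_tuple n (pell_x (3 ^ (7 + m)) div 3 ^ 8) (pell_y (3 ^ (7 + m)))" for m
  have eq: "3 ^ 8 * (pell_x (3 ^ (7 + m)) div 3 ^ 8) = pell_x (3 ^ (7 + m))" for m
  proof -
    have "(3::int) ^ 8 dvd 3 ^ Suc (7 + m)"
      by (rule le_imp_power_dvd) simp
    then have "3 ^ 8 dvd pell_x (3 ^ (7 + m))"
      using three_power_dvd_pell_x by (rule dvd_trans)
    then show ?thesis
      by (rule dvd_mult_div_cancel)
  qed
  have "range f \<subseteq> int_solutions n (pell_system n)"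
    unfolding f_def using assms eq pell_equation
    by (auto intro!: pell_tuple_solution simp only:)
  moreover have "f m 8 = pell_x (3 ^ (7 + m))" for m
    using assms eq[of m] by (simp add: f_def pell_tuple_def)
  then have "inj f"
    using strict_mono_pell_x by (intro injI) (metis add_left_cancel power_inject_exp strict_mono_eq
        one_less_numeral_iff semiring_norm(77))
  then have "infinite (range f)"
    by (simp add: finite_image_iff)
  ultimately show ?thesis
    by (rule infinite_super)
qed

text \<open>
  Variable \<open>12\<close> exceeds \<open>2 ^ 2 ^ 11\<close> because \<open>2 \<cdot> 3\<^sup>7 > 2\<^bsup>11\<^esup>\<close>, and squaring carries the bound along the
  chain to variable \<open>n\<close>.
\<close>

lemma pell_system_solution_large:
  assumes "12 \<le> n" "x \<in> int_solutions n (pell_system n)"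
  shows "2 ^ 2 ^ (n - 1) < x n"
proof -
  have sat: "\<forall>e\<in>pell_system n. satisfies x e"
    using assms(2) by (simp add: int_solutions_def)
  then have eqs: "x 1 = 1" "x 1 + x 1 = x 2" "x 1 + x 2 = x 3" "x 3 * x 3 = x 4" "x 4 * x 4 = x 5"
      "x 5 * x 5 = x 6" "x 6 * x 7 = x 8" "x 9 * x 9 = x 10" "x 10 + x 10 = x 11"
      "x 11 + x 1 = x 12" "x 8 * x 8 = x 12"
    unfolding pell_system_def ball_Un ball_simps satisfies.simps by blast+
  have "x 3 = 3"
    using eqs(1-3) by linarith
  then have "x 6 = 3 ^ 8"
    by (simp flip: eqs(4-6))
  moreover have "x 12 = (x 8)\<^sup>2"
    by (simp add: power2_eq_square eqs(11))
  moreover have "x 12 = 2 * (x 9)\<^sup>2 + 1"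
    using eqs(1,9,10) by (simp add: power2_eq_square eqs(8))
  ultimately have "3 ^ Suc 7 dvd x 8" "(x 8)\<^sup>2 = 2 * (x 9)\<^sup>2 + 1"
    by (simp_all flip: eqs(7))
  then have "2 ^ 3 ^ 7 \<le> \<bar>x 8\<bar>"
    by (rule pell_x_lower_bound[rotated])
  then have "(2 ^ 3 ^ 7)\<^sup>2 \<le> \<bar>x 8\<bar>\<^sup>2"
    by (rule power_mono) simp
  moreover have "(2::int) ^ 2 ^ 11 < 2 ^ (3 ^ 7 * 2)"
    by (rule power_strict_increasing) simp_all
  ultimately have large12: "2 ^ 2 ^ 11 < x 12"
    using \<open>x 12 = (x 8)\<^sup>2\<close> by (simp only: power_mult power2_abs)
  have "m \<le> n \<longrightarrow> 2 ^ 2 ^ (m - 1) < x m" if "12 \<le> m" for m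
    using that
  proof (induction m rule: dec_induct)
    case base
    show ?case using large12 by simp
  next
    case (step m)
    show ?case
    proof
      assume "Suc m \<le> n"
      then have "EqMult m m (Suc m) \<in> pell_system n"
        using step by (auto simp: pell_system_def)
      then have "x (Suc m) = (x m)\<^sup>2"
        using sat by (auto simp: power2_eq_square)
      moreover have "(2 ^ 2 ^ (m - 1))\<^sup>2 < (x m)\<^sup>2"
        using step \<open>Suc m \<le> n\<close> by (intro power_strict_mono) simp_all
      moreover have "2 ^ m = 2 ^ (m - 1) * (2::nat)"
        using step by (cases m) simp_all
      ultimately show "2 ^ 2 ^ (Suc m - 1) < x (Suc m)"
        by (simp only: diff_Suc_1 power_mult)
    qed
  qed
  then show ?thesis
    using assms by simp
qed

theorem theorem1:
  fixes n :: nat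
  assumes "n \<ge> 12"
  shows "\<exists>S \<subseteq> E n. infinite (int_solutions n S) \<and>
    int_solutions n S \<subseteq> tuples n UNIV - tuples n {- (2 ^ 2 ^ (n - 1)) .. 2 ^ 2 ^ (n - 1)}"
proof (intro exI[of _ "pell_system n"] conjI subsetI)
  fix x
  assume x: "x \<in> int_solutions n (pell_system n)"
  have "x n \<notin> {- (2 ^ 2 ^ (n - 1)) .. 2 ^ 2 ^ (n - 1)}"
    using pell_system_solution_large[OF assms x] by simp
  moreover have "n \<in> {1..n}"
    using assms by simp
  ultimately have "x \<notin> tuples n {- (2 ^ 2 ^ (n - 1)) .. 2 ^ 2 ^ (n - 1)}"
    unfolding tuples_def by (blast dest: PiE_mem)
  then show "x \<in> tuples n UNIV - tuples n {- (2 ^ 2 ^ (n - 1)) .. 2 ^ 2 ^ (n - 1)}"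
    using x by (simp add: int_solutions_def)
qed (use assms pell_system_subset infinite_pell_system_solutions in auto)

end
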